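(* Let $A \in \mathbb{R}^{n\times n}$, $B \in \mathbb{R}^{n \times m}$, $C \in \mathbb{R}^{p \times n}$, $D \in \mathbb{R}^{p\times m}$ be such that $(A,B)$ is controllable and $(C,A)$ is observable, and let $\ell$ be the lag of the system. Let $L > \ell$ be an integer and let $T := n+(m+1)L-1$. Let $x(0) \in \mathbb{R}^n$ be arbitrary, and for a sequence of inputs $u(0),u(1),\dots,u(T-1) \in \mathbb{R}^m$ let the states and outputs be generated by $x(t+1) = A x(t) + B u(t)$, $y(t) = C x(t) + D u(t)$. Let the inputs be selected successively in time according to the following procedure. Select $u(0),u(1),\dots,u(L-1) \in \mathbb{R}^m$ arbitrarily, but not all zero. For $t = L, L+1, \dots, T-1$, given $u(0),\dots,u(t-1)$ (and hence $y(0),\dots,y(t-1)$), select $u(t)$ as follows: (a) If $$\begin{bmatrix} y_{[t-L+1,t-1]} \\ u_{[t-L+1,t-1]} \end{bmatrix} \notin \operatorname{im} \begin{bmatrix} \mathcal{H}_{L-1}(y_{[0,t-2]}) \\ \mathcal{H}_{L-1}(u_{[0,t-2]}) \end{bmatrix},$$ choose $u(t) \in \mathbb{R}^m$ arbitrarily. (b) If $$\begin{bmatrix} y_{[t-L+1,t-1]} \\ u_{[t-L+1,t-1]} \end{bmatrix} \in \operatorname{im} \begin{bmatrix} \mathcal{H}_{L-1}(y_{[0,t-2]}) \\ \mathcal{H}_{L-1}(u_{[0,t-2]}) \end{bmatrix},$$ take some $\xi_1,\dots,\xi_{L-1} \in \mathbb{R}^p$ and $\eta_1,\dots,\eta_L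 \in \mathbb{R}^m$ with $\eta_1 \neq 0$ such that $$\begin{bmatrix} \xi_{L-1}^\top & \cdots & \xi_1^\top & \eta_L^\top & \cdots & \eta_1^\top \end{bmatrix} \begin{bmatrix} \mathcal{H}_{L-1}(y_{[0,t-2]}) \\ \mathcal{H}_L(u_{[0,t-1]}) \end{bmatrix} = 0,$$ and choose $u(t)$ such that $$\xi_{L-1}^\top y(t-L+1) + \cdots + \xi_1^\top y(t-1) + \eta_L^\top u(t-L+1) + \cdots + \eta_1^\top u(t) \neq 0.$$ Then: 1. The procedure can always be carried out: for every $t \in \{L,\dots,T-1\}$ and all inputs $u(0),\dots,u(t-1)$ selected according to the procedure, if the inclusion in (b) holds, then vectors $\xi_1,\dots,\xi_{L-1} \in \mathbb{R}^p$ and $\eta_1,\dots,\eta_L \in \mathbb{R}^m$ with $\eta_1 \neq 0$ as required in (b) exist. 2. For every input sequence $u(0),\dots,u(T-1)$ obtained from the procedure (for any choices made in it), $$\operatorname{rank} \begin{bmatrix} \mathcal{H}_L(y_{[0,T-1]}) \\ \mathcal{H}_L(u_{[0,T-1]}) \end{bmatrix} = n+mL.$$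
   Context: $n, m, p \geq 1$ are integers. The pair $(A,B)$ is controllable if $\operatorname{rank}\begin{bmatrix} B & AB & \cdots & A^{n-1}B\end{bmatrix} = n$. For $i \geq 1$ let $\mathcal{O}_i := \begin{bmatrix} C^\top & (CA)^\top & \cdots & (CA^{i-1})^\top \end{bmatrix}^\top$; the pair $(C,A)$ is observable if $\operatorname{rank} \mathcal{O}_n = n$. The lag $\ell$ of the system is the smallest integer $i$ for which $\mathcal{O}_i$ has rank $n$ (so $\ell \ge 1$ and $L \geq 2$). For a signal $f$ with values in $\mathbb{R}^q$ and integers $i \le j$, $f_{[i,j]}$ denotes the stacked column vector $\begin{bmatrix} f(i)^\top & f(i+1)^\top & \cdots & f(j)^\top \end{bmatrix}^\top$, and also (by abuse of notation) the sequence $f(i),\dots,f(j)$. For $1 \le k \le j-i+1$, the Hankel matrix of depth $k$ is the matrix with $k$ block rows $$\mathcal{H}_k(f_{[i,j]}) := \begin{bmatrix} f(i) & f(i+1) & \cdots & f(j-k+1) \\ f(i+1) & f(i+2) & \cdots & f(j-k+2) \\ \vdots & \vdots & & \vdots \\ f(i+k-1) & f(i+k) & \cdots & f(j) \end{bmatrix},$$ i.e. its columns are $f_{[s,s+k-1]}$ for $s = i,\dots,j-k+1$. $\operatorname{im}$ denotes the column space of a matrix. *)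

theory Defs
  imports "Jordan_Normal_Form.DL_Rank"
begin

definition mat_rank :: "real mat \<Rightarrow> nat" where
  "mat_rank M = vec_space.rank (dim_row M) M"

definition im :: "real mat \<Rightarrow> real vec set" where
  "im M = vec_space.col_space (dim_row M) M"

definition ctrb_mat :: "real mat \<Rightarrow> real mat \<Rightarrow> real mat" where
  "ctrb_mat A B = (let n = dim_row A; m = dim_col B in
     mat n (n * m) (\<lambda>(r, c). (A ^\<^sub>m (c div m) * B) $$ (r, c mod m)))"

definition controllable :: "real mat \<Rightarrow> real mat \<Rightarrow> bool" where
  "controllable A B \<longleftrightarrow> mat_rank (ctrb_mat A B) = dim_row A"

definition obsv_mat :: "real mat \<Rightarrow> real mat \<Rightarrow> nat \<Rightarrow> real mat" where
  "obsv_mat C A i = (let n = dim_row A; p = dim_row C in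
     mat (i * p) n (\<lambda>(r, c). (C * A ^\<^sub>m (r div p)) $$ (r mod p, c)))"

definition observable :: "real mat \<Rightarrow> real mat \<Rightarrow> bool" where
  "observable C A \<longleftrightarrow> mat_rank (obsv_mat C A (dim_row A)) = dim_row A"

definition lag :: "real mat \<Rightarrow> real mat \<Rightarrow> nat" where
  "lag C A = (LEAST i. 1 \<le> i \<and> mat_rank (obsv_mat C A i) = dim_row A)"

primrec sys_state :: "real mat \<Rightarrow> real mat \<Rightarrow> real vec \<Rightarrow> (nat \<Rightarrow> real vec) \<Rightarrow> nat \<Rightarrow> real vec" where
  "sys_state A B x0 u 0 = x0"
| "sys_state A B x0 u (Suc t) = A *\<^sub>v sys_state A B x0 u t + B *\<^sub>v u t"

definition sys_output ::
  "real mat \<Rightarrow> real mat \<Rightarrow> real mat \<Rightarrow> real mat \<Rightarrow> real vec \<Rightarrow> (nat \<Rightarrow> real vec) \<Rightarrow> nat \<Rightarrow> real vec" where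
  "sys_output A B C D x0 u t = C *\<^sub>v sys_state A B x0 u t + D *\<^sub>v u t"

text \<open>For a signal \<open>f\<close> with values in dimension \<open>q\<close>, \<open>window q f i j\<close> stacks
  \<open>f i, \<dots>, f j\<close> into one column vector of dimension \<open>(j - i + 1) q\<close>.\<close>

definition window :: "nat \<Rightarrow> (nat \<Rightarrow> real vec) \<Rightarrow> nat \<Rightarrow> nat \<Rightarrow> real vec" where
  "window q f i j = vec ((j + 1 - i) * q) (\<lambda>r. f (i + r div q) $ (r mod q))"

text \<open>\<open>hankel q k f i j\<close> has depth \<open>k\<close> and uses the samples \<open>f i, \<dots>, f j\<close>; it is meant for
  \<open>1 \<le> k \<le> j - i + 1\<close>, when the start \<open>s\<close> of a column ranges over \<open>i, \<dots>, j - k + 1\<close>.\<close>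

definition hankel :: "nat \<Rightarrow> nat \<Rightarrow> (nat \<Rightarrow> real vec) \<Rightarrow> nat \<Rightarrow> nat \<Rightarrow> real mat" where
  "hankel q k f i j = mat_of_cols (k * q) (map (\<lambda>s. window q f s (s + k - 1)) [i..<j + 2 - k])"

definition window_in_im ::
  "nat \<Rightarrow> nat \<Rightarrow> nat \<Rightarrow> (nat \<Rightarrow> real vec) \<Rightarrow> (nat \<Rightarrow> real vec) \<Rightarrow> nat \<Rightarrow> bool" where
  "window_in_im m p L u y t \<longleftrightarrow>
     window p y (t - L + 1) (t - 1) @\<^sub>v window m u (t - L + 1) (t - 1)
       \<in> im (hankel p (L - 1) y 0 (t - 2) @\<^sub>r hankel m (L - 1) u 0 (t - 2))"

text \<open>In the row vector the blocks are listed with decreasing index,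
  \<open>\<xi> (L - 1), \<dots>, \<xi> 1, \<eta> L, \<dots>, \<eta> 1\<close>.\<close>

definition annihilator ::
  "nat \<Rightarrow> nat \<Rightarrow> nat \<Rightarrow> (nat \<Rightarrow> real vec) \<Rightarrow> (nat \<Rightarrow> real vec) \<Rightarrow> nat \<Rightarrow>
    (nat \<Rightarrow> real vec) \<Rightarrow> (nat \<Rightarrow> real vec) \<Rightarrow> bool" where
  "annihilator m p L u y t \<xi> \<eta> \<longleftrightarrow>
     (\<forall>i\<in>{1..L - 1}. \<xi> i \<in> carrier_vec p) \<and>
     (\<forall>i\<in>{1..L}. \<eta> i \<in> carrier_vec m) \<and>
     \<eta> 1 \<noteq> 0\<^sub>v m \<and>
     mat_of_row (window p (\<lambda>k. \<xi> (L - 1 - k)) 0 (L - 2) @\<^sub>v window m (\<lambda>k. \<eta> (L - k)) 0 (L - 1))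
       * (hankel p (L - 1) y 0 (t - 2) @\<^sub>r hankel m L u 0 (t - 1)) = 0\<^sub>m 1 (t - L + 1)"

text \<open>The choice of \<open>u t\<close> at a time \<open>t \<ge> L\<close>; only the values of \<open>u\<close> and \<open>y\<close> before \<open>t\<close>,
  and \<open>u t\<close> itself, matter.\<close>

definition admissible_input ::
  "nat \<Rightarrow> nat \<Rightarrow> nat \<Rightarrow> (nat \<Rightarrow> real vec) \<Rightarrow> (nat \<Rightarrow> real vec) \<Rightarrow> nat \<Rightarrow> bool" where
  "admissible_input m p L u y t \<longleftrightarrow>
     u t \<in> carrier_vec m \<and>
     (window_in_im m p L u y t \<longrightarrow>
       (\<exists>\<xi> \<eta>. annihilator m p L u y t \<xi> \<eta> \<and>
         (\<Sum>i = 1..L - 1. \<xi> i \<bullet> y (t - i)) + (\<Sum>i = 1..L. \<eta> i \<bullet> u (t - i + 1)) \<noteq> 0))"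

text \<open>The inputs selected so far are \<open>u 0, \<dots>, u (N - 1)\<close>, where \<open>N \<ge> L\<close>; later values of \<open>u\<close>
  are unconstrained. The signal \<open>y\<close> is meant to be the output resulting from \<open>u\<close>.\<close>

definition selected ::
  "nat \<Rightarrow> nat \<Rightarrow> nat \<Rightarrow> (nat \<Rightarrow> real vec) \<Rightarrow> (nat \<Rightarrow> real vec) \<Rightarrow> nat \<Rightarrow> bool" where
  "selected m p L u y N \<longleftrightarrow>
     (\<forall>t<L. u t \<in> carrier_vec m) \<and> (\<exists>t<L. u t \<noteq> 0\<^sub>v m) \<and>
     (\<forall>t\<in>{L..<N}. admissible_input m p L u y t)"

end

theory Submission
  imports Defs
begin

text \<open>
  Rank: in a nontrivial linear relation between the columns of the depth \<open>L\<close> Hankel matrix, the last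
  column occurring, with start \<open>s\<close>, is a combination of earlier ones. If \<open>s = 0\<close>, the first \<open>L\<close>
  inputs vanish. Otherwise the truncated relation puts time \<open>t = s + L - 1\<close> into case (b), and the
  annihilator used there kills the earlier columns but, by the choice of \<open>u t\<close>, not the new one.
  Hence all \<open>n + m L\<close> columns are independent.

  Existence of the annihilator: by observability, annihilators of the input-output data correspond to
  functionals \<open>(z, a)\<close> vanishing on the vectors \<open>(x s, u s, \<dots>, u (s + L - 1))\<close> with \<open>s \<le> t - L\<close>,
  with \<open>\<eta> 1\<close> corresponding to the last block of \<open>a\<close>. There are fewer than \<open>n + m L\<close> such vectors,
  so some functional is nonzero. If the last block of every such functional were zero, the inclusion
  in (b) would extend them to \<open>s = t - L + 1\<close>, and composing with the system step would map
  \<open>(z, a)\<close> to the functional \<open>(A\<^sup>T z, (B\<^sup>T z, a 0, \<dots>, a (L - 2)))\<close>. Iterating, all blocks of \<open>a\<close>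
  and all \<open>B\<^sup>T (A\<^sup>T)\<^sup>k z\<close> vanish, so \<open>z = 0\<close> by controllability, a contradiction.
\<close>

subsection \<open>Rank and kernels\<close>

text \<open>Supplies the maximal independent set from which \<open>rank_card_indpt\<close> reads off
  the rank. It exists because the empty set is independent and there are finitely many
  columns.\<close>

lemma (in vec_space) maximal_indpt_columns:
  "\<exists>S. maximal S (\<lambda>T. T \<subseteq> set (cols M) \<and> lin_indpt T)"
  using maximal_exists_superset[of "set (cols M)" "\<lambda>T. T \<subseteq> set (cols M) \<and> lin_indpt T" "{}"]
  by (metis (no_types, lifting) List.finite_set empty_subsetI subset_li_is_li
      fin_dim finite_basis_exists basis_def)

lemma mult_mat_unit_vec:
  assumes "(M :: real mat) \<in> carrier_mat nr nc" and "i < nc"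
  shows "M *\<^sub>v unit_vec nc i = col M i"
  using assms by (intro eq_vecI) (auto simp: scalar_prod_right_unit)

text \<open>Independence refers to the set of columns, so repetitions are excluded separately: a
  repetition makes the set too small for rank \<open>nc\<close>, and it yields the kernel vector
  \<open>unit_vec nc i - unit_vec nc j\<close>.\<close>

lemma full_column_rank_iff:
  assumes M: "M \<in> carrier_mat nr nc"
  shows "mat_rank M = nc \<longleftrightarrow> (\<forall>v\<in>carrier_vec nc. M *\<^sub>v v = 0\<^sub>v nr \<longrightarrow> v = 0\<^sub>v nc)"
proof -
  interpret V: vec_space "TYPE(real)" nr .
  have rank: "mat_rank M = V.rank M"
    using M by (simp add: mat_rank_def)
  have len: "length (cols M) = nc"
    using M by simp
  show ?thesis
  proof
    assume full: "mat_rank M = nc"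
    obtain S where S: "maximal S (\<lambda>T. T \<subseteq> set (cols M) \<and> V.lin_indpt T)"
      using V.maximal_indpt_columns by blast
    have "card S \<le> card (set (cols M))"
      using S by (auto simp: maximal_def intro: card_mono)
    then have "card (set (cols M)) = length (cols M)"
      using V.rank_card_indpt[OF M S] full rank len card_length[of "cols M"] by simp
    then have dist: "distinct (cols M)"
      by (rule card_distinct)
    then have "V.lin_indpt (set (cols M))"
      using V.full_rank_lin_indpt[OF M _ dist] full rank by simp
    then show "\<forall>v\<in>carrier_vec nc. M *\<^sub>v v = 0\<^sub>v nr \<longrightarrow> v = 0\<^sub>v nc"
      using V.lin_depI[OF M _ _ _ dist] by blast
  next
    assume inj: "\<forall>v\<in>carrier_vec nc. M *\<^sub>v v = 0\<^sub>v nr \<longrightarrow> v = 0\<^sub>v nc"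
    have dist: "distinct (cols M)"
    proof (rule ccontr)
      assume "\<not> distinct (cols M)"
      then obtain i j where ij: "i < nc" "j < nc" "i \<noteq> j" "col M i = col M j"
        using len M by (auto simp: distinct_conv_nth)
      have "M *\<^sub>v (unit_vec nc i - unit_vec nc j) = col M i - col M j"
        using M ij by (simp add: mult_minus_distrib_mat_vec[of _ nr nc] mult_mat_unit_vec)
      also have "\<dots> = 0\<^sub>v nr"
        using M ij by (intro eq_vecI) auto
      finally have "unit_vec nc i - unit_vec nc j = (0\<^sub>v nc :: real vec)"
        using inj by auto
      then have "(unit_vec nc i - unit_vec nc j) $ i = (0\<^sub>v nc :: real vec) $ i"
        by simp
      then show False
        using ij by simp
    qed
    have "V.lin_indpt (set (cols M))"
      using V.lin_depE[OF M _ dist] inj by metis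
    then show "mat_rank M = nc"
      using V.lin_indpt_full_rank[OF M dist] rank by simp
  qed
qed

lemma det_transpose_mult_vec_eq_0:
  assumes Q: "(Q :: real mat) \<in> carrier_mat n n" and "det Q \<noteq> 0"
    and "z \<in> carrier_vec n" and "Q\<^sup>T *\<^sub>v z = 0\<^sub>v n"
  shows "z = 0\<^sub>v n"
  using assms det_0_iff_vec_prod_zero_field[of "Q\<^sup>T" n] by (auto simp: det_transpose)

text \<open>A maximal independent set of columns has \<open>nr\<close> members and hence forms an
  invertible matrix. A vector orthogonal to all columns of \<open>M\<close> is in particular
  orthogonal to these.\<close>

lemma full_row_rank_left_kernel:
  assumes M: "M \<in> carrier_mat nr nc" and full: "mat_rank M = nr"
    and z: "z \<in> carrier_vec nr" and ker: "M\<^sup>T *\<^sub>v z = 0\<^sub>v nc"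
  shows "z = 0\<^sub>v nr"
proof -
  interpret V: vec_space "TYPE(real)" nr .
  obtain S where S: "maximal S (\<lambda>T. T \<subseteq> set (cols M) \<and> V.lin_indpt T)"
    using V.maximal_indpt_columns by blast
  have S': "S \<subseteq> set (cols M)" "V.lin_indpt S"
    using S by (auto simp: maximal_def)
  then have "finite S"
    using finite_subset by blast
  then obtain cs where cs: "set cs = S" "distinct cs"
    using finite_distinct_list by blast
  have "length cs = nr"
    using V.rank_card_indpt[OF M S] full cs distinct_card[of cs] M by (simp add: mat_rank_def)
  moreover have "S \<subseteq> carrier_vec nr"
    using S' M cols_dim[of M] by auto
  ultimately have Q: "mat_of_cols nr cs \<in> carrier_mat nr nr" "cols (mat_of_cols nr cs) = cs"
    using cs by auto
  then have "det (mat_of_cols nr cs) \<noteq> 0"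
    using V.lin_indpt_full_rank[OF Q(1)] V.det_rank_iff[OF Q(1)] S' cs by simp
  moreover have "(mat_of_cols nr cs)\<^sup>T *\<^sub>v z = 0\<^sub>v nr"
  proof (rule eq_vecI)
    fix i assume "i < dim_vec (0\<^sub>v nr :: real vec)"
    then have i: "i < nr" by simp
    then have "cs ! i \<in> set (cols M)"
      using S' cs \<open>length cs = nr\<close> nth_mem by blast
    then obtain j where j: "j < nc" "cs ! i = col M j"
      using M by (metis carrier_matD(2) cols_length cols_nth in_set_conv_nth)
    have "col M j \<bullet> z = (M\<^sup>T *\<^sub>v z) $ j"
      using j M by simp
    then have "col M j \<bullet> z = 0"
      using ker j by simp
    moreover have "col (mat_of_cols nr cs) i = cs ! i"
      using Q i by (metis carrier_matD(2) cols_nth)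
    ultimately show "((mat_of_cols nr cs)\<^sup>T *\<^sub>v z) $ i = 0\<^sub>v nr $ i"
      using i j carrier_matD[OF Q(1)] by simp
  qed (use Q \<open>length cs = nr\<close> in simp)
  ultimately show ?thesis
    using det_transpose_mult_vec_eq_0[OF Q(1)] z by blast
qed

text \<open>Padding with zero rows gives a singular square matrix, and its kernel vectors are kernel
  vectors of \<open>M\<close>.\<close>

lemma wide_mat_kernel:
  assumes M: "(M :: real mat) \<in> carrier_mat nr nc" and "nr < nc"
  obtains v where "v \<in> carrier_vec nc" "v \<noteq> 0\<^sub>v nc" "M *\<^sub>v v = 0\<^sub>v nr"
proof -
  define Q where "Q = mat nc nc (\<lambda>(i, j). if i < nr then M $$ (i, j) else 0)"
  have Q: "Q \<in> carrier_mat nc nc"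
    by (simp add: Q_def)
  have "Q\<^sup>T *\<^sub>v unit_vec nc (nc - 1) = 0\<^sub>v nc"
    using \<open>nr < nc\<close> Q by (subst mult_mat_unit_vec[of _ nc]) (auto simp: Q_def intro!: eq_vecI)
  moreover have "unit_vec nc (nc - 1) \<noteq> (0\<^sub>v nc :: real vec)"
    using \<open>nr < nc\<close> by (intro unit_vec_nonzero) simp
  ultimately have "det Q = 0"
    using det_transpose_mult_vec_eq_0[OF Q] by (meson unit_vec_carrier)
  then obtain v where v: "v \<in> carrier_vec nc" "v \<noteq> 0\<^sub>v nc" "Q *\<^sub>v v = 0\<^sub>v nc"
    using det_0_iff_vec_prod_zero_field[OF Q] by blast
  have "(M *\<^sub>v v) $ i = 0" if "i < nr" for i
  proof -
    have "row M i = row Q i"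
      using that M \<open>nr < nc\<close> by (auto simp: Q_def intro!: eq_vecI)
    then have "(M *\<^sub>v v) $ i = (Q *\<^sub>v v) $ i"
      using that M Q \<open>nr < nc\<close> by simp
    then show ?thesis
      using v that \<open>nr < nc\<close> by simp
  qed
  then have "M *\<^sub>v v = 0\<^sub>v nr"
    using M by (intro eq_vecI) auto
  then show thesis
    using that v by blast
qed

lemma full_column_rank_row_space:
  assumes M: "(M :: real mat) \<in> carrier_mat nr nc" and full: "mat_rank M = nc"
    and z: "z \<in> carrier_vec nc"
  obtains w where "w \<in> carrier_vec nc" "M\<^sup>T *\<^sub>v (M *\<^sub>v w) = z"
proof -
  \<comment> \<open>The Gram matrix is invertible, so \<open>w\<close> is obtained by solving \<open>G w = z\<close>.\<close>
  define G where "G = M\<^sup>T * M"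
  have G: "G \<in> carrier_mat nc nc" 
    using M by (auto simp: G_def)
  have G_mult: "G *\<^sub>v w = M\<^sup>T *\<^sub>v (M *\<^sub>v w)" if "w \<in> carrier_vec nc" for w
    using that M unfolding G_def by (intro assoc_mult_mat_vec[of _ nc nr _ nc]) auto
  have "det G \<noteq> 0"
  proof
    assume "det G = 0"
    then obtain v where v: "v \<in> carrier_vec nc" "v \<noteq> 0\<^sub>v nc" "G *\<^sub>v v = 0\<^sub>v nc"
      using det_0_iff_vec_prod_zero_field[OF G] by blast
    have Mv: "M *\<^sub>v v \<in> carrier_vec nr"
      using M v by auto
    have "(M *\<^sub>v v) \<bullet> (M *\<^sub>v v) = (M\<^sup>T *\<^sub>v (M *\<^sub>v v)) \<bullet> v"
      using transpose_vec_mult_scalar[OF M v(1) Mv] by simp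
    also have "\<dots> = 0"
      unfolding G_mult[OF v(1), symmetric] v(3) using v(1) by simp
    \<comment> \<open>Conjugation is trivial over the reals, so definiteness of
      \<open>\<bullet>c\<close> applies.\<close>
    finally have "(M *\<^sub>v v) \<bullet>c (M *\<^sub>v v) = 0"
      by (simp add: conjugate_real_def scalar_prod_def)
    then have "M *\<^sub>v v = 0\<^sub>v nr"
      using conjugate_square_eq_0_vec[OF Mv] by simp
    then show False
      using full_column_rank_iff[OF M] full v by blast
  qed
  then obtain H where H: "H \<in> carrier_mat nc nc" "G * H = 1\<^sub>m nc"
    using det_non_zero_imp_unit[OF G] by (auto simp: Units_def ring_mat_def)
  have "G *\<^sub>v (H *\<^sub>v z) = z"
    using assoc_mult_mat_vec[OF G H(1) z] H z by simp
  then show thesis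
    using that[of "H *\<^sub>v z"] G_mult H z by simp
qed

subsection \<open>Hankel matrices\<close>

lemma dim_window [simp]: "dim_vec (window q f i j) = (j + 1 - i) * q"
  by (simp add: window_def)

text \<open>In a stacked vector, \<open>r div q\<close> is the block number and
  \<open>r mod q\<close> the position inside the block, so the sum can be taken interval by
  interval.\<close>

lemma sum_blocks:
  fixes F :: "nat \<Rightarrow> nat \<Rightarrow> real"
  shows "(\<Sum>r = 0..<k * q. F (r div q) (r mod q)) = (\<Sum>i<k. \<Sum>r<q. F i r)"
proof (cases "q = 0")
  case False
  have "(\<Sum>r = 0..<k * q. F (r div q) (r mod q))
      = (\<Sum>i<k. \<Sum>r\<in>{i * q..<i * q + q}. F (r div q) (r mod q))"
    by (simp add: sum.nat_group atLeast0LessThan)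
  also have "\<dots> = (\<Sum>i<k. \<Sum>r<q. F i r)"
  proof (rule sum.cong [OF refl])
    fix i
    have "(\<Sum>r\<in>{i * q..<i * q + q}. F (r div q) (r mod q)) = (\<Sum>r = 0..<q. F ((r + i * q) div q) ((r + i * q) mod q))"
      using sum.shift_bounds_nat_ivl[of "\<lambda>r. F (r div q) (r mod q)" 0 "i * q" q] by (simp add: add.commute)
    also have "\<dots> = (\<Sum>r<q. F i r)"
      using False by (intro sum.cong) auto
    finally show "(\<Sum>r\<in>{i * q..<i * q + q}. F (r div q) (r mod q)) = (\<Sum>r<q. F i r)" .
  qed
  finally show ?thesis .
qed simp

text \<open>The carrier condition concerns the right factor because \<open>scalar_prod\<close> takes
  its summation range from there.\<close>

lemma scalar_prod_window:
  assumes "k \<ge> 1" and "\<And>i. i < k \<Longrightarrow> g (b + i) \<in> carrier_vec q"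
  shows "window q f a (a + k - 1) \<bullet> window q g b (b + k - 1) = (\<Sum>i<k. f (a + i) \<bullet> g (b + i))"
proof -
  have "window q f a (a + k - 1) \<bullet> window q g b (b + k - 1)
      = (\<Sum>r = 0..<k * q. f (a + r div q) $ (r mod q) * g (b + r div q) $ (r mod q))"
    using assms(1) by (simp add: window_def scalar_prod_def)
  also have "\<dots> = (\<Sum>i<k. \<Sum>r<q. f (a + i) $ r * g (b + i) $ r)"
    by (rule sum_blocks)
  also have "\<dots> = (\<Sum>i<k. f (a + i) \<bullet> g (b + i))"
    using carrier_vecD[OF assms(2)]
    by (intro sum.cong) (simp_all add: scalar_prod_def atLeast0LessThan)
  finally show ?thesis .
qed

lemma hankel_carrier [simp]: "hankel q k f i j \<in> carrier_mat (k * q) (j + 2 - k - i)"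
  by (simp add: hankel_def mat_of_cols_def)

lemma hankel_dims [simp]:
  "dim_row (hankel q k f i j) = k * q" "dim_col (hankel q k f i j) = j + 2 - k - i"
  by (simp_all add: hankel_def mat_of_cols_def)

lemma col_hankel:
  assumes "k \<ge> 1" and "s < j + 2 - k - i"
  shows "col (hankel q k f i j) s = window q f (i + s) (i + s + k - 1)"
  using assms by (simp add: hankel_def carrier_vecI)

lemma hankel_mult_vec_index:
  assumes "k \<ge> 1" and "c \<in> carrier_vec (j + 2 - k)" and "r < k * q"
  shows "(hankel q k f 0 j *\<^sub>v c) $ r = (\<Sum>s<j + 2 - k. c $ s * f (s + r div q) $ (r mod q))"
  using assms
  by (simp add: hankel_def mat_of_cols_def scalar_prod_def window_def atLeast0LessThan mult.commute
      carrier_vecD)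

text \<open>Keeping \<open>f\<close> and \<open>g\<close> apart serves two uses:
  \<open>g = f\<close> expresses that a later column is a combination of earlier ones, while a zero
  signal \<open>g\<close> describes the kernel.\<close>

lemma window_eq_hankel_mult_iff:
  assumes "k \<ge> 1" and "c \<in> carrier_vec (j + 2 - k)"
  shows "hankel q k f 0 j *\<^sub>v c = window q g a (a + k - 1) \<longleftrightarrow>
    (\<forall>i<k. \<forall>r<q. g (a + i) $ r = (\<Sum>s<j + 2 - k. c $ s * f (s + i) $ r))" (is "?L \<longleftrightarrow> ?R")
proof
  assume L: ?L
  show ?R
  proof (intro allI impI)
    fix i r assume ir: "i < k" "r < q"
    have "i * q + r < Suc i * q"
      using ir by simp
    also have "\<dots> \<le> k * q"
      using ir by (intro mult_le_mono1) simp
    finally have "i * q + r < k * q" .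
    with L hankel_mult_vec_index[OF assms this, of f] 
    show "g (a + i) $ r = (\<Sum>s<j + 2 - k. c $ s * f (s + i) $ r)"
      using ir assms by (simp add: window_def)
  qed
next
  assume R: ?R
  show ?L
  proof (rule eq_vecI)
    fix r assume "r < dim_vec (window q g a (a + k - 1))"
    then have r: "r < k * q"
      using assms(1) by simp
    then have "0 < q"
      by (cases q) auto
    with r have "r div q < k" "r mod q < q"
      by (auto simp: less_mult_imp_div_less)
    then show "(hankel q k f 0 j *\<^sub>v c) $ r = window q g a (a + k - 1) $ r"
      using R assms r by (simp add: hankel_mult_vec_index window_def del: index_mult_mat_vec)
  qed (use assms in simp)
qed

lemma append_eq_append_rows_mult_iff:
  assumes M: "M \<in> carrier_mat a nc" "N \<in> carrier_mat b nc" and c: "c \<in> carrier_vec nc"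
    and v: "v \<in> carrier_vec a"
  shows "(M @\<^sub>r N) *\<^sub>v c = v @\<^sub>v w \<longleftrightarrow> M *\<^sub>v c = v \<and> N *\<^sub>v c = w"
  using mat_mult_append[OF M c] append_vec_eq[of "M *\<^sub>v c" a v "N *\<^sub>v c" w] M c v by auto

text \<open>The depth \<open>k\<close> Hankel column of \<open>f\<close> starting at \<open>s\<close> is the combination of the
  earlier columns with weights \<open>c\<close>.\<close>

definition past_combination :: "nat \<Rightarrow> (nat \<Rightarrow> real) \<Rightarrow> nat \<Rightarrow> nat \<Rightarrow> (nat \<Rightarrow> real vec) \<Rightarrow> bool" where
  "past_combination q c k s f \<longleftrightarrow>
     (\<forall>i<k. \<forall>r<q. f (s + i) $ r = (\<Sum>j<s. c j * f (j + i) $ r))"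

text \<open>By linearity, a relation between columns passes to the values of any functional applied
  to a block row.\<close>

lemma past_combination_scalar_prod:
  assumes "past_combination q c k s f" and "i < k" and "\<And>j. j \<le> s \<Longrightarrow> f (j + i) \<in> carrier_vec q"
  shows "v \<bullet> f (s + i) = (\<Sum>j<s. c j * (v \<bullet> f (j + i)))"
proof -
  have dims: "dim_vec (f (j + i)) = q" if "j \<le> s" for j
    using assms(3)[OF that] by (rule carrier_vecD)
  have "v \<bullet> f (s + i) = (\<Sum>r = 0..<q. v $ r * (\<Sum>j<s. c j * f (j + i) $ r))"
    using assms(1,2) dims by (simp add: scalar_prod_def past_combination_def)
  also have "\<dots> = (\<Sum>j<s. \<Sum>r = 0..<q. v $ r * (c j * f (j + i) $ r))"
    by (simp add: sum_distrib_left sum.swap[of _ "{..<s}"])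
  also have "\<dots> = (\<Sum>j<s. c j * (v \<bullet> f (j + i)))"
    using dims by (intro sum.cong) (auto simp: scalar_prod_def sum_distrib_left ac_simps)
  finally show ?thesis .
qed

text \<open>The columns of the data matrices start at times 0 to \<open>t - L\<close>, so the tested
  window is exactly the next column, with start \<open>t - L + 1\<close>.\<close>

lemma window_in_im_iff:
  assumes "2 \<le> L" and "L \<le> t"
  shows "window_in_im m p L u y t \<longleftrightarrow>
    (\<exists>c. past_combination p c (L - 1) (t - L + 1) y \<and> past_combination m c (L - 1) (t - L + 1) u)"
proof -
  let ?k = "L - 1" and ?s = "t - L + 1"
  let ?Hy = "hankel p ?k y 0 (t - 2)" and ?Hu = "hankel m ?k u 0 (t - 2)"
  interpret V: vec_space "TYPE(real)" "?k * p + ?k * m" .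
  have nc: "t - 2 + 2 - ?k = ?s" and te: "t - 1 = ?s + ?k - 1" and k: "?k \<ge> 1"
    using assms by auto
  have Hy: "?Hy \<in> carrier_mat (?k * p) ?s" and Hu: "?Hu \<in> carrier_mat (?k * m) ?s"
    using hankel_carrier[of p ?k y 0 "t - 2"] hankel_carrier[of m ?k u 0 "t - 2"] nc by auto
  then have H: "?Hy @\<^sub>r ?Hu \<in> carrier_mat (?k * p + ?k * m) ?s"
    by (rule carrier_append_rows)
  have wy: "window p y ?s (t - 1) \<in> carrier_vec (?k * p)"
    and wu: "window m u ?s (t - 1) \<in> carrier_vec (?k * m)"
    using assms by (auto intro!: carrier_vecI)
  have comb: "hankel q ?k f 0 (t - 2) *\<^sub>v c = window q f ?s (t - 1) \<longleftrightarrow>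
      past_combination q (($) c) ?k ?s f" if "c \<in> carrier_vec ?s" for q f c
    unfolding te past_combination_def
    by (rule window_eq_hankel_mult_iff[OF k, of c "t - 2", unfolded nc, OF that])
  have "window_in_im m p L u y t \<longleftrightarrow>
    (\<exists>c\<in>carrier_vec ?s. (?Hy @\<^sub>r ?Hu) *\<^sub>v c = window p y ?s (t - 1) @\<^sub>v window m u ?s (t - 1))"
    using H wy wu V.col_space_eq[OF H] carrier_matD[OF H]
    by (auto simp: window_in_im_def im_def intro: append_carrier_vec)
  also have "\<dots> \<longleftrightarrow> (\<exists>c\<in>carrier_vec ?s. ?Hy *\<^sub>v c = window p y ?s (t - 1) \<and>
      ?Hu *\<^sub>v c = window m u ?s (t - 1))"
    using append_eq_append_rows_mult_iff[OF Hy Hu _ wy] by blast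
  also have "\<dots> \<longleftrightarrow> (\<exists>c\<in>carrier_vec ?s. past_combination p (($) c) ?k ?s y \<and>
      past_combination m (($) c) ?k ?s u)"
    using comb by blast
  also have "\<dots> \<longleftrightarrow> (\<exists>c. past_combination p c ?k ?s y \<and> past_combination m c ?k ?s u)"
  proof
    \<comment> \<open>Only the weights below \<open>?s\<close> enter, so a weight function can be
      truncated to a vector.\<close>
    assume "\<exists>c. past_combination p c ?k ?s y \<and> past_combination m c ?k ?s u"
    then obtain c where "past_combination p c ?k ?s y" "past_combination m c ?k ?s u"
      by blast
    then have "past_combination p (($) (vec ?s c)) ?k ?s y \<and>
        past_combination m (($) (vec ?s c)) ?k ?s u"
      by (simp add: past_combination_def)
    then show "\<exists>c\<in>carrier_vec ?s. past_combination p (($) c) ?k ?s y \<and>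
        past_combination m (($) c) ?k ?s u"
      using vec_carrier by blast
  qed blast
  finally show ?thesis .
qed

lemma mat_of_row_mult_append_rows_index:
  assumes "x \<in> carrier_vec a" and "e \<in> carrier_vec b"
    and "M \<in> carrier_mat a nc" and "N \<in> carrier_mat b nc" and "s < nc"
  shows "(mat_of_row (x @\<^sub>v e) * (M @\<^sub>r N)) $$ (0, s) = x \<bullet> col M s + e \<bullet> col N s"
  unfolding mat_of_row_mult_append_rows[OF assms(1-4)] using assms by simp

text \<open>Entry \<open>s\<close> of the matrix product is the functional applied to the data
  starting at \<open>s\<close>. The coefficients are indexed backwards in time, whence
  \<open>L - 1 - i\<close> and \<open>L - i\<close>.\<close>

lemma annihilator_iff:
  assumes "2 \<le> L" and "L \<le> t"
    and y: "\<And>s. s < t \<Longrightarrow> y s \<in> carrier_vec p" and u: "\<And>s. s < t \<Longrightarrow> u s \<in> carrier_vec m"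
  shows "annihilator m p L u y t \<xi> \<eta> \<longleftrightarrow>
    (\<forall>i\<in>{1..L - 1}. \<xi> i \<in> carrier_vec p) \<and> (\<forall>i\<in>{1..L}. \<eta> i \<in> carrier_vec m) \<and> \<eta> 1 \<noteq> 0\<^sub>v m \<and>
    (\<forall>s<t - L + 1. (\<Sum>i<L - 1. \<xi> (L - 1 - i) \<bullet> y (s + i)) + (\<Sum>i<L. \<eta> (L - i) \<bullet> u (s + i)) = 0)"
proof -
  let ?s = "t - L + 1"
  let ?Hy = "hankel p (L - 1) y 0 (t - 2)" and ?Hu = "hankel m L u 0 (t - 1)"
  let ?x = "window p (\<lambda>k. \<xi> (L - 1 - k)) 0 (L - 2)" and ?e = "window m (\<lambda>k. \<eta> (L - k)) 0 (L - 1)"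
  \<comment> \<open>The output block is one row shallower and ends one sample earlier than the input
    block, so both have the same number of columns.\<close>
  have ncy: "t - 2 + 2 - (L - 1) = ?s" and ncu: "t - 1 + 2 - L = ?s"
    using assms by auto
  have Hy: "?Hy \<in> carrier_mat ((L - 1) * p) ?s" and Hu: "?Hu \<in> carrier_mat (L * m) ?s"
    using hankel_carrier[of p "L - 1" y 0 "t - 2"] hankel_carrier[of m L u 0 "t - 1"] ncy ncu by auto
  have x: "?x \<in> carrier_vec ((L - 1) * p)" and e: "?e \<in> carrier_vec (L * m)"
    using assms by (auto intro!: carrier_vecI simp: Suc_diff_Suc numeral_2_eq_2)
  have entry: "(mat_of_row (?x @\<^sub>v ?e) * (?Hy @\<^sub>r ?Hu)) $$ (0, s)
      = (\<Sum>i<L - 1. \<xi> (L - 1 - i) \<bullet> y (s + i)) + (\<Sum>i<L. \<eta> (L - i) \<bullet> u (s + i))"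
    if s: "s < ?s" for s
  proof -
    have "(mat_of_row (?x @\<^sub>v ?e) * (?Hy @\<^sub>r ?Hu)) $$ (0, s) = ?x \<bullet> col ?Hy s + ?e \<bullet> col ?Hu s"
      by (rule mat_of_row_mult_append_rows_index[OF x e Hy Hu s])
    also have "?x \<bullet> col ?Hy s = (\<Sum>i<L - 1. \<xi> (L - 1 - i) \<bullet> y (s + i))"
      using scalar_prod_window[of "L - 1" y s p "\<lambda>k. \<xi> (L - 1 - k)" 0] y assms(1,2) s ncy
        col_hankel[of "L - 1" s "t - 2" 0 p y] by (simp add: numeral_2_eq_2)
    also have "?e \<bullet> col ?Hu s = (\<Sum>i<L. \<eta> (L - i) \<bullet> u (s + i))"
      using scalar_prod_window[of L u s m "\<lambda>k. \<eta> (L - k)" 0] u assms(1,2) s ncu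
        col_hankel[of L s "t - 1" 0 m u] by simp
    finally show ?thesis .
  qed
  have "mat_of_row (?x @\<^sub>v ?e) * (?Hy @\<^sub>r ?Hu) = 0\<^sub>m 1 ?s \<longleftrightarrow>
      (\<forall>s<?s. (mat_of_row (?x @\<^sub>v ?e) * (?Hy @\<^sub>r ?Hu)) $$ (0, s) = 0)" (is "?M = _ \<longleftrightarrow> _")
  proof
    assume "\<forall>s<?s. ?M $$ (0, s) = 0"
    then show "?M = 0\<^sub>m 1 ?s"
      using carrier_matD[OF carrier_append_rows[OF Hy Hu]] by (intro eq_matI) auto
  qed simp
  then show ?thesis
    unfolding annihilator_def using entry by auto
qed

subsection \<open>Controllability and observability\<close>

lemma obsv_mat_carrier:
  assumes "A \<in> carrier_mat n n" and "C \<in> carrier_mat p n"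
  shows "obsv_mat C A i \<in> carrier_mat (i * p) n"
  using assms by (simp add: obsv_mat_def)

lemma obsv_mat_mult_vec:
  assumes A: "A \<in> carrier_mat n n" and C: "C \<in> carrier_mat p n" and v: "v \<in> carrier_vec n"
    and r: "r < i * p"
  shows "(obsv_mat C A i *\<^sub>v v) $ r = (C *\<^sub>v (A ^\<^sub>m (r div p) *\<^sub>v v)) $ (r mod p)"
proof -
  have p: "r mod p < p"
    using r by (cases p) auto
  have "row (obsv_mat C A i) r = row (C * A ^\<^sub>m (r div p)) (r mod p)"
    using A C p r carrier_matD[OF pow_carrier_mat[OF A, of "r div p"]]
    by (intro eq_vecI) (auto simp: obsv_mat_def simp del: pow_mat_dim)
  moreover have "C * A ^\<^sub>m (r div p) *\<^sub>v v = C *\<^sub>v (A ^\<^sub>m (r div p) *\<^sub>v v)"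
    using assms by (intro assoc_mult_mat_vec[of _ p n _ n]) auto
  ultimately show ?thesis
    using assms p obsv_mat_carrier[OF A C, of i] by (metis carrier_matD(1) index_mult_mat(2) index_mult_mat_vec)
qed

text \<open>The smaller matrix consists of the top rows of the larger one, so the kernel only
  shrinks as the depth grows.\<close>

lemma obsv_mat_full_rank_mono:
  assumes A: "A \<in> carrier_mat n n" and C: "C \<in> carrier_mat p n"
    and "mat_rank (obsv_mat C A i) = n" and "i \<le> j"
  shows "mat_rank (obsv_mat C A j) = n"
  unfolding full_column_rank_iff[OF obsv_mat_carrier[OF A C]]
proof (intro ballI impI)
  fix v assume v: "v \<in> carrier_vec n" and ker: "obsv_mat C A j *\<^sub>v v = 0\<^sub>v (j * p)"
  have "(obsv_mat C A i *\<^sub>v v) $ r = 0" if "r < i * p" for r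
  proof -
    have "r < j * p"
      using that mult_le_mono1[OF \<open>i \<le> j\<close>, of p] by linarith
    then show ?thesis
      using obsv_mat_mult_vec[OF A C v] that ker by (metis index_zero_vec(1))
  qed
  then have "obsv_mat C A i *\<^sub>v v = 0\<^sub>v (i * p)"
    using obsv_mat_carrier[OF A C, of i] by (intro eq_vecI) auto
  then show "v = 0\<^sub>v n"
    using assms(3) full_column_rank_iff[OF obsv_mat_carrier[OF A C]] v by blast
qed

lemma obsv_mat_full_rank_lag:
  assumes A: "A \<in> carrier_mat n n" and "1 \<le> n" and "observable C A"
  shows "1 \<le> lag C A" "mat_rank (obsv_mat C A (lag C A)) = n"
proof -
  have "1 \<le> n \<and> mat_rank (obsv_mat C A n) = dim_row A"
    using assms by (simp add: observable_def)
  from LeastI[of "\<lambda>i. 1 \<le> i \<and> mat_rank (obsv_mat C A i) = dim_row A", OF this]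
  show "1 \<le> lag C A" "mat_rank (obsv_mat C A (lag C A)) = n"
    using A by (auto simp: lag_def)
qed

text \<open>The columns of the controllability matrix are columns of matrices
  \<open>A ^\<^sub>m k * B\<close>, so \<open>z\<close> lies in its left kernel, which is trivial by
  full row rank.\<close>

lemma controllable_left_kernel:
  assumes A: "A \<in> carrier_mat n n" and B: "B \<in> carrier_mat n m" and ctrb: "controllable A B"
    and z: "z \<in> carrier_vec n" and ker: "\<And>k. (A ^\<^sub>m k * B)\<^sup>T *\<^sub>v z = 0\<^sub>v m"
  shows "z = 0\<^sub>v n"
proof -
  have M: "ctrb_mat A B \<in> carrier_mat n (n * m)"
    using A B by (simp add: ctrb_mat_def)
  have "((ctrb_mat A B)\<^sup>T *\<^sub>v z) $ c = 0" if c: "c < n * m" for c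
  proof -
    have m: "c mod m < m"
      using c by (cases m) auto
    have AB: "A ^\<^sub>m (c div m) * B \<in> carrier_mat n m"
      using A B by auto
    have "col (ctrb_mat A B) c = col (A ^\<^sub>m (c div m) * B) (c mod m)"
      using A B c m carrier_matD[OF AB] by (intro eq_vecI) (auto simp: ctrb_mat_def)
    then have "((ctrb_mat A B)\<^sup>T *\<^sub>v z) $ c = ((A ^\<^sub>m (c div m) * B)\<^sup>T *\<^sub>v z) $ (c mod m)"
      using M carrier_matD[OF AB] c m by simp
    then show ?thesis
      using ker m by simp
  qed
  then have "(ctrb_mat A B)\<^sup>T *\<^sub>v z = 0\<^sub>v (n * m)"
    using M by (intro eq_vecI) auto
  then show ?thesis
    using full_row_rank_left_kernel[OF M _ z] ctrb A by (auto simp: controllable_def)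
qed

text \<open>The recursion of \<open>^\<^sub>m\<close> puts the new factor on the right. With it on
  the left, transposing lets \<open>A\<^sup>T\<close> act on a functional first.\<close>

lemma pow_mat_Suc_mult:
  assumes A: "(A :: real mat) \<in> carrier_mat n n" and B: "B \<in> carrier_mat n m"
  shows "A ^\<^sub>m Suc k * B = A * (A ^\<^sub>m k * B)"
proof -
  have "A ^\<^sub>m Suc k = A * A ^\<^sub>m k"
  proof (induction k)
    case (Suc k)
    then show ?case
      using A by (simp add: assoc_mult_mat[of _ n n _ n _ n])
  qed (use A in simp)
  then show ?thesis
    using assms by (simp add: assoc_mult_mat[of _ n n _ n _ m])
qed

section \<open>Linear functionals along system trajectories\<close>

lemma sys_state_carrier:
  assumes "A \<in> carrier_mat n n" and "B \<in> carrier_mat n m" and "x0 \<in> carrier_vec n"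
  shows "sys_state A B x0 u t \<in> carrier_vec n"
  using assms by (cases t) (auto intro!: carrier_vecI)

lemma sys_output_carrier:
  assumes "D \<in> carrier_mat p m"
  shows "sys_output A B C D x0 u t \<in> carrier_vec p"
  using assms by (auto simp: sys_output_def intro!: carrier_vecI)

text \<open>Solving the recursion for the free response leaves only input terms, with
  \<open>b j\<close> equal to the negative of
  \<open>(A ^\<^sub>m (i - 1 - j) * B)\<^sup>T *\<^sub>v q\<close>. It matters that \<open>b\<close>
  does not depend on \<open>s\<close>.\<close>

lemma free_response_functional:
  fixes q :: "real vec"
  assumes A: "A \<in> carrier_mat n n" and B: "B \<in> carrier_mat n m" and x0: "x0 \<in> carrier_vec n"
    and u: "\<And>s. s < t \<Longrightarrow> u s \<in> carrier_vec m" and q: "q \<in> carrier_vec n"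
  defines "x \<equiv> sys_state A B x0 u"
  shows "\<exists>b. (\<forall>j. b j \<in> carrier_vec m) \<and> (\<forall>s. s + i \<le> t \<longrightarrow>
    q \<bullet> (A ^\<^sub>m i *\<^sub>v x s) = q \<bullet> x (s + i) + (\<Sum>j<i. b j \<bullet> u (s + j)))"
proof (induction i)
  case 0
  have "A ^\<^sub>m 0 *\<^sub>v x s = x s" for s
    using A sys_state_carrier[OF A B x0, of u s] by (simp add: x_def)
  then show ?case
    by (intro exI[of _ "\<lambda>_. 0\<^sub>v m"]) simp
next
  case (Suc i)
  then obtain b where b: "\<And>j. b j \<in> carrier_vec m"
    and IH: "\<And>s. s + i \<le> t \<Longrightarrow> q \<bullet> (A ^\<^sub>m i *\<^sub>v x s) = q \<bullet> x (s + i) + (\<Sum>j<i. b j \<bullet> u (s + j))"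
    by blast
  have x: "x s \<in> carrier_vec n" for s
    unfolding x_def by (rule sys_state_carrier[OF A B x0])
  \<comment> \<open>The induction starts the shorter trajectory one step later, at
    \<open>Suc s\<close>. The old coefficients therefore move up by one and the contribution of
    \<open>u s\<close> comes first.\<close>
  define b' where "b' j = (case j of 0 \<Rightarrow> - ((A ^\<^sub>m i * B)\<^sup>T *\<^sub>v q) | Suc j \<Rightarrow> b j)" for j
  have AB: "A ^\<^sub>m i * B \<in> carrier_mat n m" and Ai: "A ^\<^sub>m i \<in> carrier_mat n n"
    using A B by auto
  have "q \<bullet> (A ^\<^sub>m Suc i *\<^sub>v x s) = q \<bullet> x (s + Suc i) + (\<Sum>j<Suc i. b' j \<bullet> u (s + j))"
    if s: "s + Suc i \<le> t" for s
  proof -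
    have us: "u s \<in> carrier_vec m"
      using s u by simp
    have "A ^\<^sub>m i *\<^sub>v x (Suc s) = A ^\<^sub>m i *\<^sub>v (A *\<^sub>v x s) + A ^\<^sub>m i *\<^sub>v (B *\<^sub>v u s)"
      using A B Ai x us by (simp add: x_def mult_add_distrib_mat_vec[of _ n n])
    also have "A ^\<^sub>m i *\<^sub>v (A *\<^sub>v x s) = A ^\<^sub>m Suc i *\<^sub>v x s"
      using assoc_mult_mat_vec[OF Ai A x] by simp
    also have "A ^\<^sub>m i *\<^sub>v (B *\<^sub>v u s) = A ^\<^sub>m i * B *\<^sub>v u s"
      using assoc_mult_mat_vec[OF Ai B us] by simp
    finally have "q \<bullet> (A ^\<^sub>m i *\<^sub>v x (Suc s)) = q \<bullet> (A ^\<^sub>m Suc i *\<^sub>v x s) + q \<bullet> (A ^\<^sub>m i * B *\<^sub>v u s)"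
      using mult_mat_vec_carrier[OF pow_carrier_mat[OF A, of "Suc i"] x] mult_mat_vec_carrier[OF AB us] q
      by (simp del: pow_mat.simps add: scalar_prod_add_distrib[of _ n])
    moreover have "q \<bullet> (A ^\<^sub>m i * B *\<^sub>v u s) = - (b' 0 \<bullet> u s)"
      using transpose_vec_mult_scalar[OF AB us q] us AB B by (simp add: b'_def)
    ultimately show ?thesis
      using IH[of "Suc s"] s unfolding sum.lessThan_Suc_shift by (simp add: b'_def)
  qed
  moreover have "b' j \<in> carrier_vec m" for j
    using b AB q by (cases j) (auto simp: b'_def)
  ultimately show ?case
    by blast
qed

text \<open>Each output is the free response plus input terms, and these are collected in
  coefficients that are the same for all \<open>s\<close>. The bound on \<open>s + k\<close> keeps
  all inputs before time \<open>t\<close>.\<close>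

lemma output_functional:
  assumes A: "A \<in> carrier_mat n n" and B: "B \<in> carrier_mat n m"
    and C: "C \<in> carrier_mat p n" and D: "D \<in> carrier_mat p m" and x0: "x0 \<in> carrier_vec n"
    and u: "\<And>s. s < t \<Longrightarrow> u s \<in> carrier_vec m" and \<rho>: "\<And>i. \<rho> i \<in> carrier_vec p"
  defines "x \<equiv> sys_state A B x0 u" and "y \<equiv> sys_output A B C D x0 u"
  shows "\<exists>b. (\<forall>j. b j \<in> carrier_vec m) \<and> (\<forall>s. s + k \<le> t \<longrightarrow>
    (\<Sum>i<k. \<rho> i \<bullet> (C *\<^sub>v (A ^\<^sub>m i *\<^sub>v x s))) = (\<Sum>i<k. \<rho> i \<bullet> y (s + i)) + (\<Sum>i<k. b i \<bullet> u (s + i)))"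
proof (induction k)
  case 0
  show ?case
    by (intro exI[of _ "\<lambda>_. 0\<^sub>v m"]) simp
next
  case (Suc k)
  then obtain b where b: "\<And>j. b j \<in> carrier_vec m"
    and IH: "\<And>s. s + k \<le> t \<Longrightarrow> (\<Sum>i<k. \<rho> i \<bullet> (C *\<^sub>v (A ^\<^sub>m i *\<^sub>v x s)))
      = (\<Sum>i<k. \<rho> i \<bullet> y (s + i)) + (\<Sum>i<k. b i \<bullet> u (s + i))"
    by blast
  have x: "x s \<in> carrier_vec n" for s
    unfolding x_def by (rule sys_state_carrier[OF A B x0])
  have q: "C\<^sup>T *\<^sub>v \<rho> k \<in> carrier_vec n"
    using C \<rho> by auto
  obtain b1 where b1: "\<And>j. b1 j \<in> carrier_vec m"
    and free: "\<And>s. s + k \<le> t \<Longrightarrow> (C\<^sup>T *\<^sub>v \<rho> k) \<bullet> (A ^\<^sub>m k *\<^sub>v x s)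
      = (C\<^sup>T *\<^sub>v \<rho> k) \<bullet> x (s + k) + (\<Sum>j<k. b1 j \<bullet> u (s + j))"
    using free_response_functional[where u = u and t = t and i = k, OF A B x0 u q] unfolding x_def by blast
  \<comment> \<open>Row \<open>k\<close> adds its forced response to the earlier coefficients and
    its feedthrough term at position \<open>k\<close>.\<close>
  define b' where "b' j = (if j < k then b j + b1 j else - (D\<^sup>T *\<^sub>v \<rho> k))" for j
  have "(\<Sum>i<Suc k. \<rho> i \<bullet> (C *\<^sub>v (A ^\<^sub>m i *\<^sub>v x s)))
      = (\<Sum>i<Suc k. \<rho> i \<bullet> y (s + i)) + (\<Sum>i<Suc k. b' i \<bullet> u (s + i))"
    if s: "s + Suc k \<le> t" for s
  proof -
    have us: "u (s + j) \<in> carrier_vec m" if "j \<le> k" for j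
      using s u that by simp
    have "A ^\<^sub>m k *\<^sub>v x s \<in> carrier_vec n"
      using A x by (intro mult_mat_vec_carrier[of _ n n]) auto
    then have "\<rho> k \<bullet> (C *\<^sub>v (A ^\<^sub>m k *\<^sub>v x s)) = (C\<^sup>T *\<^sub>v \<rho> k) \<bullet> (A ^\<^sub>m k *\<^sub>v x s)"
      by (rule transpose_vec_mult_scalar[OF C _ \<rho>, symmetric])
    also have "\<dots> = (C\<^sup>T *\<^sub>v \<rho> k) \<bullet> x (s + k) + (\<Sum>j<k. b1 j \<bullet> u (s + j))"
      using free s by simp
    also have "(C\<^sup>T *\<^sub>v \<rho> k) \<bullet> x (s + k) = \<rho> k \<bullet> (C *\<^sub>v x (s + k))"
      by (rule transpose_vec_mult_scalar[OF C x \<rho>])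
    also have "\<dots> = \<rho> k \<bullet> y (s + k) - \<rho> k \<bullet> (D *\<^sub>v u (s + k))"
      using C D x us \<rho> by (simp add: y_def sys_output_def x_def[symmetric] scalar_prod_add_distrib[of _ p])
    also have "\<rho> k \<bullet> (D *\<^sub>v u (s + k)) = - (b' k \<bullet> u (s + k))"
      using transpose_vec_mult_scalar[OF D us[OF order_refl] \<rho>, of k] us[of k] D by (simp add: b'_def)
    finally have "\<rho> k \<bullet> (C *\<^sub>v (A ^\<^sub>m k *\<^sub>v x s))
        = \<rho> k \<bullet> y (s + k) + b' k \<bullet> u (s + k) + (\<Sum>j<k. b1 j \<bullet> u (s + j))"
      by simp
    moreover have "(\<Sum>j<k. b' j \<bullet> u (s + j)) = (\<Sum>j<k. b j \<bullet> u (s + j)) + (\<Sum>j<k. b1 j \<bullet> u (s + j))"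
      using b b1 us by (simp add: b'_def add_scalar_prod_distrib[of _ m] sum.distrib)
    ultimately show ?thesis
      using IH[of s] s by simp
  qed
  moreover have "b' j \<in> carrier_vec m" for j
    using b b1 D \<rho> by (auto simp: b'_def)
  ultimately show ?case
    by blast
qed

text \<open>By full column rank, \<open>z\<close> is a combination of rows of the observability
  matrix, so its value on a state is read off from free responses and hence from \<open>k\<close>
  outputs and inputs.\<close>

lemma state_functional:
  assumes A: "A \<in> carrier_mat n n" and B: "B \<in> carrier_mat n m"
    and C: "C \<in> carrier_mat p n" and D: "D \<in> carrier_mat p m" and x0: "x0 \<in> carrier_vec n"
    and u: "\<And>s. s < t \<Longrightarrow> u s \<in> carrier_vec m"
    and full: "mat_rank (obsv_mat C A k) = n" and z: "z \<in> carrier_vec n"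
  obtains \<rho> b where "\<And>i. \<rho> i \<in> carrier_vec p" and "\<And>i. b i \<in> carrier_vec m"
    and "\<And>s. s + k \<le> t \<Longrightarrow> z \<bullet> sys_state A B x0 u s
      = (\<Sum>i<k. \<rho> i \<bullet> sys_output A B C D x0 u (s + i)) + (\<Sum>i<k. b i \<bullet> u (s + i))"
proof -
  let ?O = "obsv_mat C A k"
  have O: "?O \<in> carrier_mat (k * p) n"
    by (rule obsv_mat_carrier[OF A C])
  obtain w where w: "w \<in> carrier_vec n" "?O\<^sup>T *\<^sub>v (?O *\<^sub>v w) = z"
    using full_column_rank_row_space[OF O full z] by blast
  \<comment> \<open>These are the blocks of \<open>?O *\<^sub>v w\<close>, the coefficients in the
    combination of rows giving \<open>z\<close>.\<close>
  define \<rho> where "\<rho> i = C *\<^sub>v (A ^\<^sub>m i *\<^sub>v w)" for i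
  have \<rho>: "\<rho> i \<in> carrier_vec p" for i
    using C by (auto simp: \<rho>_def intro!: carrier_vecI)
  have "z \<bullet> v = (\<Sum>i<k. \<rho> i \<bullet> (C *\<^sub>v (A ^\<^sub>m i *\<^sub>v v)))" if v: "v \<in> carrier_vec n" for v
  proof -
    have Ow: "?O *\<^sub>v w \<in> carrier_vec (k * p)"
      using O w by auto
    have "z \<bullet> v = (?O *\<^sub>v w) \<bullet> (?O *\<^sub>v v)"
      using transpose_vec_mult_scalar[OF O v Ow] w by simp
    also have "\<dots> = (\<Sum>r = 0..<k * p. (?O *\<^sub>v w) $ r * (?O *\<^sub>v v) $ r)"
      using carrier_matD[OF O] by (simp add: scalar_prod_def del: index_mult_mat_vec)
    also have "\<dots> = (\<Sum>r = 0..<k * p. \<rho> (r div p) $ (r mod p) * (C *\<^sub>v (A ^\<^sub>m (r div p) *\<^sub>v v)) $ (r mod p))"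
      unfolding \<rho>_def
      by (intro sum.cong refl) (simp only: obsv_mat_mult_vec[OF A C] v w(1) atLeastLessThan_iff)
    also have "\<dots> = (\<Sum>i<k. \<Sum>r<p. \<rho> i $ r * (C *\<^sub>v (A ^\<^sub>m i *\<^sub>v v)) $ r)"
      by (rule sum_blocks)
    also have "\<dots> = (\<Sum>i<k. \<rho> i \<bullet> (C *\<^sub>v (A ^\<^sub>m i *\<^sub>v v)))"
      using C by (simp add: scalar_prod_def atLeast0LessThan del: index_mult_mat_vec)
    finally show ?thesis .
  qed
  then have z_free: "z \<bullet> sys_state A B x0 u s = (\<Sum>i<k. \<rho> i \<bullet> (C *\<^sub>v (A ^\<^sub>m i *\<^sub>v sys_state A B x0 u s)))" for s
    using sys_state_carrier[OF A B x0] by blast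
  obtain b where "\<forall>j. b j \<in> carrier_vec m" and "\<forall>s. s + k \<le> t \<longrightarrow>
      (\<Sum>i<k. \<rho> i \<bullet> (C *\<^sub>v (A ^\<^sub>m i *\<^sub>v sys_state A B x0 u s)))
        = (\<Sum>i<k. \<rho> i \<bullet> sys_output A B C D x0 u (s + i)) + (\<Sum>i<k. b i \<bullet> u (s + i))"
    using output_functional[where u = u and t = t and k = k and \<rho> = \<rho>, OF A B C D x0 u \<rho>] by blast
  then show thesis
    using that[of \<rho> b] \<rho> by (simp add: z_free)
qed

subsection \<open>The input design procedure\<close>

lemma selected_full_column_rank:
  assumes L: "2 \<le> L" "L \<le> T"
    and y: "\<And>s. s < T \<Longrightarrow> y s \<in> carrier_vec p"
    and u: "\<And>s. s < T \<Longrightarrow> u s \<in> carrier_vec m"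
    and sel: "selected m p L u y T"
  shows "mat_rank (hankel p L y 0 (T - 1) @\<^sub>r hankel m L u 0 (T - 1)) = T - L + 1"
proof -
  let ?N = "T - L + 1"
  let ?Hy = "hankel p L y 0 (T - 1)" and ?Hu = "hankel m L u 0 (T - 1)"
  have nc: "T - 1 + 2 - L = ?N" and L1: "1 \<le> L"
    using L by auto
  have Hy: "?Hy \<in> carrier_mat (L * p) ?N" and Hu: "?Hu \<in> carrier_mat (L * m) ?N"
    using hankel_carrier[of p L y 0 "T - 1"] hankel_carrier[of m L u 0 "T - 1"] nc by auto
  have "c = 0\<^sub>v ?N" if c: "c \<in> carrier_vec ?N" and ker: "(?Hy @\<^sub>r ?Hu) *\<^sub>v c = 0\<^sub>v (L * p + L * m)" for c
  proof (rule ccontr)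
    assume "c \<noteq> 0\<^sub>v ?N"
    then have ex: "\<exists>j. j < ?N \<and> c $ j \<noteq> 0"
      using c by (metis carrier_vecD eq_vecI index_zero_vec)
    define s where "s = Max {j. j < ?N \<and> c $ j \<noteq> 0}"
    have "s \<in> {j. j < ?N \<and> c $ j \<noteq> 0}"
      unfolding s_def using ex by (intro Max_in) auto
    then have s: "s < ?N" "c $ s \<noteq> 0"
      by auto
    have c0: "c $ j = 0" if "s < j" "j < ?N" for j
    proof (rule ccontr)
      assume "c $ j \<noteq> 0"
      then have "j \<le> s"
        unfolding s_def using that by (intro Max_ge) auto
      then show False
        using that by simp
    qed
    \<comment> \<open>Solving the relation for its last column, the one with start \<open>s\<close>,
      gives these weights.\<close>
    define d where "d j = - (c $ j) / c $ s" for j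
    have comb: "past_combination q d L s f"
      if "hankel q L f 0 (T - 1) *\<^sub>v c = 0\<^sub>v (L * q)" for q f
      unfolding past_combination_def
    proof (intro allI impI)
      fix i r assume ir: "i < L" "r < q"
      \<comment> \<open>A kernel vector represents the window of the zero signal.\<close>
      have "window q (\<lambda>_. 0\<^sub>v q) 0 (0 + L - 1) = (0\<^sub>v (L * q) :: real vec)"
        using L by (cases "q = 0") (auto simp: window_def intro!: eq_vecI)
      then have "0 = (\<Sum>j<?N. c $ j * f (j + i) $ r)"
        using window_eq_hankel_mult_iff[OF L1, of c "T - 1" q f "\<lambda>_. 0\<^sub>v q" 0] that ir c nc by simp
      also have "\<dots> = (\<Sum>j<Suc s. c $ j * f (j + i) $ r)"
        using s c0 by (intro sum.mono_neutral_right) auto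
      finally show "f (s + i) $ r = (\<Sum>j<s. d j * f (j + i) $ r)"
        using s(2) by (simp add: d_def field_simps sum_negf flip: sum_divide_distrib)
    qed
    have zero: "0\<^sub>v (L * p + L * m) = (0\<^sub>v (L * p) @\<^sub>v 0\<^sub>v (L * m) :: real vec)"
      by (intro eq_vecI) auto
    have comb_y: "past_combination p d L s y" and comb_u: "past_combination m d L s u"
      using ker append_eq_append_rows_mult_iff[OF Hy Hu c, of "0\<^sub>v (L * p)"] comb
      unfolding zero by auto
    have "s \<noteq> 0"
    proof
      \<comment> \<open>The combination is then empty, so the initial inputs would all
        vanish.\<close>
      assume "s = 0"
      then have "u i = 0\<^sub>v m" if "i < L" for i
        using comb_u that u[of i] L by (intro eq_vecI) (auto simp: past_combination_def)
      then show False
        using sel by (auto simp: selected_def)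
    qed
    \<comment> \<open>The time of the last sample in column \<open>s\<close>;
      \<open>s \<noteq> 0\<close> gives \<open>L \<le> t\<close>. Dropping that sample from the
      relation gives the inclusion of case (b).\<close>
    define t where "t = s + L - 1"
    have t: "L \<le> t" "t < T" "t - L + 1 = s"
      using s \<open>s \<noteq> 0\<close> L by (auto simp: t_def)
    have "window_in_im m p L u y t"
      unfolding window_in_im_iff[OF L(1) t(1)] t(3)
      using comb_y comb_u by (intro exI[of _ d]) (auto simp: past_combination_def)
    then obtain \<xi> \<eta> where ann: "annihilator m p L u y t \<xi> \<eta>"
      and new: "(\<Sum>i = 1..L - 1. \<xi> i \<bullet> y (t - i)) + (\<Sum>i = 1..L. \<eta> i \<bullet> u (t - i + 1)) \<noteq> 0"
      using sel t by (auto simp: selected_def admissible_input_def)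
    have old: "(\<Sum>i<L - 1. \<xi> (L - 1 - i) \<bullet> y (j + i)) + (\<Sum>i<L. \<eta> (L - i) \<bullet> u (j + i)) = 0"
      if "j < s" for j
      using ann that y u t by (subst (asm) annihilator_iff[OF L(1) t(1)]) auto
    have "(\<Sum>i = 1..L - 1. \<xi> i \<bullet> y (t - i)) = (\<Sum>i<L - 1. \<xi> (L - 1 - i) \<bullet> y (s + i))"
      using L \<open>s \<noteq> 0\<close>
      by (intro sum.reindex_bij_witness[of _ "\<lambda>i. L - 1 - i" "\<lambda>i. L - 1 - i"]) (auto simp: t_def)
    also have "\<dots> = (\<Sum>i<L - 1. \<Sum>j<s. d j * (\<xi> (L - 1 - i) \<bullet> y (j + i)))"
      using s L by (intro sum.cong past_combination_scalar_prod[OF comb_y] y refl) auto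
    also have "\<dots> = (\<Sum>j<s. d j * (\<Sum>i<L - 1. \<xi> (L - 1 - i) \<bullet> y (j + i)))"
      by (subst sum.swap) (simp add: sum_distrib_left)
    finally have sum_y: "(\<Sum>i = 1..L - 1. \<xi> i \<bullet> y (t - i)) = \<dots>" .
    have "(\<Sum>i = 1..L. \<eta> i \<bullet> u (t - i + 1)) = (\<Sum>i<L. \<eta> (L - i) \<bullet> u (s + i))"
      using L \<open>s \<noteq> 0\<close>
      by (intro sum.reindex_bij_witness[of _ "\<lambda>i. L - i" "\<lambda>i. L - i"]) (auto simp: t_def Suc_diff_Suc)
    also have "\<dots> = (\<Sum>i<L. \<Sum>j<s. d j * (\<eta> (L - i) \<bullet> u (j + i)))"
      using s L by (intro sum.cong past_combination_scalar_prod[OF comb_u] u refl) auto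
    also have "\<dots> = (\<Sum>j<s. d j * (\<Sum>i<L. \<eta> (L - i) \<bullet> u (j + i)))"
      by (subst sum.swap) (simp add: sum_distrib_left)
    finally have "(\<Sum>i = 1..L - 1. \<xi> i \<bullet> y (t - i)) + (\<Sum>i = 1..L. \<eta> i \<bullet> u (t - i + 1))
        = (\<Sum>j<s. d j * ((\<Sum>i<L - 1. \<xi> (L - 1 - i) \<bullet> y (j + i)) + (\<Sum>i<L. \<eta> (L - i) \<bullet> u (j + i))))"
      unfolding sum_y by (simp add: distrib_left sum.distrib)
    also have "\<dots> = 0"
      using old by simp
    finally show False
      using new by simp
  qed
  then show ?thesis
    using full_column_rank_iff[OF carrier_append_rows[OF Hy Hu]] by blast
qed

section \<open>Existence of annihilators\<close>

lemma few_columns_annihilated: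
  assumes x: "\<And>s. s < N \<Longrightarrow> x s \<in> carrier_vec n" and u: "\<And>s i. s < N \<Longrightarrow> i < L \<Longrightarrow> u (s + i) \<in> carrier_vec m"
    and N: "N < n + L * m" and L: "1 \<le> L"
  obtains z a where "z \<in> carrier_vec n" and "\<And>i. a i \<in> carrier_vec m"
    and "z \<noteq> 0\<^sub>v n \<or> (\<exists>i<L. a i \<noteq> 0\<^sub>v m)"
    and "\<And>s. s < N \<Longrightarrow> z \<bullet> x s + (\<Sum>i<L. a i \<bullet> u (s + i)) = (0 :: real)"
proof -
  \<comment> \<open>The given vectors become the rows of a matrix with more columns than rows; a
    kernel vector is then split into its state part \<open>z\<close> and input blocks
    \<open>a i\<close>.\<close>
  define K where "K = mat_of_rows (n + L * m) (map (\<lambda>s. x s @\<^sub>v window m u s (s + L - 1)) [0..<N])"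
  have K: "K \<in> carrier_mat N (n + L * m)"
    by (simp add: K_def carrier_matI)
  obtain v where v: "v \<in> carrier_vec (n + L * m)" "v \<noteq> 0\<^sub>v (n + L * m)" "K *\<^sub>v v = 0\<^sub>v N"
    using wide_mat_kernel[OF K N] by blast
  define z where "z = vec_first v n"
  define a where "a i = vec m (\<lambda>r. vec_last v (L * m) $ (i * m + r))" for i
  have w: "window m a 0 (0 + L - 1) = vec_last v (L * m)"
  proof (rule eq_vecI)
    fix r assume "r < dim_vec (vec_last v (L * m))"
    then have "r < L * m" by simp
    moreover from this have "r mod m < m"
      by (cases m) auto
    ultimately show "window m a 0 (0 + L - 1) $ r = vec_last v (L * m) $ r"
      using L by (simp add: window_def a_def)
  qed (use L in simp)
  have v_split: "v = z @\<^sub>v window m a 0 (0 + L - 1)"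
    unfolding w z_def using v(1) by simp
  have wu: "window m u s (s + L - 1) \<in> carrier_vec (L * m)" for s
    using L by (intro carrier_vecI) simp
  show thesis
  proof (rule that[of z a])
    show "z \<in> carrier_vec n" "a i \<in> carrier_vec m" for i
      by (simp_all add: z_def a_def)
    show "z \<noteq> 0\<^sub>v n \<or> (\<exists>i<L. a i \<noteq> 0\<^sub>v m)"
    proof (rule ccontr)
      assume "\<not> ?thesis"
      then have "z = 0\<^sub>v n" and a: "\<And>i. i < L \<Longrightarrow> a i = 0\<^sub>v m"
        by auto
      have "window m a 0 (0 + L - 1) = 0\<^sub>v (L * m)"
      proof (rule eq_vecI)
        fix r assume "r < dim_vec (0\<^sub>v (L * m) :: real vec)"
        then have r: "r < L * m" by simp
        then have "r div m < L" "r mod m < m"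
          by (auto simp: less_mult_imp_div_less) (cases m, auto)
        then show "window m a 0 (0 + L - 1) $ r = 0\<^sub>v (L * m) $ r"
          using r a L by (simp add: window_def)
      qed (use L in simp)
      then have "v = 0\<^sub>v n @\<^sub>v 0\<^sub>v (L * m)"
        using v_split \<open>z = 0\<^sub>v n\<close> L by auto
      also have "\<dots> = 0\<^sub>v (n + L * m)"
        by (intro eq_vecI) auto
      finally show False
        using v(2) by simp
    qed
    fix s assume s: "s < N"
    have "row K s = x s @\<^sub>v window m u s (s + L - 1)"
      using s x wu by (simp add: K_def)
    then have "0 = (x s @\<^sub>v window m u s (s + L - 1)) \<bullet> v"
      using v(3) K s by (metis carrier_matD(1) index_mult_mat_vec index_zero_vec(1))
    also have "\<dots> = v \<bullet> (x s @\<^sub>v window m u s (s + L - 1))"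
      using s x wu v(1) by (intro comm_scalar_prod[of _ "n + L * m"]) auto
    also have "\<dots> = z \<bullet> x s + window m a 0 (0 + L - 1) \<bullet> window m u s (s + L - 1)"
      unfolding v_split using s x wu w
      by (intro scalar_prod_append[of _ n _ "L * m"]) (auto simp: z_def)
    also have "\<dots> = z \<bullet> x s + (\<Sum>i<L. a i \<bullet> u (s + i))"
      using scalar_prod_window[of L u s m a 0] L u s by simp
    finally show "z \<bullet> x s + (\<Sum>i<L. a i \<bullet> u (s + i)) = 0"
      by simp
  qed
qed

text \<open>The adjoint of the state update. It pulls a functional back by one time step and creates
  the input block \<open>B\<^sup>T *\<^sub>v z\<close>.\<close>

lemma functional_step:
  assumes A: "A \<in> carrier_mat n n" and B: "B \<in> carrier_mat n m" and z: "z \<in> carrier_vec n"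
    and x: "x \<in> carrier_vec n" and v: "v \<in> carrier_vec m"
  shows "z \<bullet> (A *\<^sub>v x + B *\<^sub>v v) = (A\<^sup>T *\<^sub>v z) \<bullet> x + (B\<^sup>T *\<^sub>v z) \<bullet> (v :: real vec)"
  unfolding transpose_vec_mult_scalar[OF A x z] transpose_vec_mult_scalar[OF B v z]
  using assms by (intro scalar_prod_add_distrib[of _ n]) auto

lemma annihilator_exists:
  assumes n: "1 \<le> n"
    and A: "A \<in> carrier_mat n n" and B: "B \<in> carrier_mat n m"
    and C: "C \<in> carrier_mat p n" and D: "D \<in> carrier_mat p m"
    and ctrb: "controllable A B" and obs: "observable C A" and lag: "lag C A < L"
    and x0: "x0 \<in> carrier_vec n"
    and t: "L \<le> t" "t - L + 1 < n + m * L"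
    and u: "\<And>s. s < t \<Longrightarrow> u s \<in> carrier_vec m"
    and win: "window_in_im m p L u (sys_output A B C D x0 u) t"
  shows "\<exists>\<xi> \<eta>. annihilator m p L u (sys_output A B C D x0 u) t \<xi> \<eta>"
proof -
  define x where "x = sys_state A B x0 u"
  define y where "y = sys_output A B C D x0 u"
  have x: "x s \<in> carrier_vec n" for s
    unfolding x_def by (rule sys_state_carrier[OF A B x0])
  have y: "y s \<in> carrier_vec p" for s
    unfolding y_def by (rule sys_output_carrier[OF D])
  have L: "2 \<le> L" and full: "mat_rank (obsv_mat C A (L - 1)) = n"
    using obsv_mat_full_rank_lag[OF A n obs] lag obsv_mat_full_rank_mono[OF A C, of "lag C A" "L - 1"]
    by auto
  let ?N = "t - L + 1"
  obtain c where cy: "past_combination p c (L - 1) ?N y" and cu: "past_combination m c (L - 1) ?N u"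
    using win window_in_im_iff[OF L t(1)] unfolding y_def by blast
  have comb_u: "v \<bullet> u (?N + i) = (\<Sum>s<?N. c s * (v \<bullet> u (s + i)))" if "i < L - 1" for v i
    using that t(1) by (intro past_combination_scalar_prod[OF cu] u) auto
  \<comment> \<open>A state is determined by \<open>L - 1\<close> outputs and inputs, with
    coefficients independent of time. The combination in the inclusion thus carries over from data
    to states.\<close>
  have comb_x: "z \<bullet> x ?N = (\<Sum>s<?N. c s * (z \<bullet> x s))" if z: "z \<in> carrier_vec n" for z
  proof -
    obtain \<rho> b where "\<And>i. \<rho> i \<in> carrier_vec p" and "\<And>i. b i \<in> carrier_vec m"
      and zx: "\<And>s. s + (L - 1) \<le> t \<Longrightarrow>
        z \<bullet> x s = (\<Sum>i<L - 1. \<rho> i \<bullet> y (s + i)) + (\<Sum>i<L - 1. b i \<bullet> u (s + i))"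
      unfolding x_def y_def by (rule state_functional[where u = u and t = t, OF A B C D x0 u full z]) blast+
    have "z \<bullet> x ?N = (\<Sum>i<L - 1. \<rho> i \<bullet> y (?N + i)) + (\<Sum>i<L - 1. b i \<bullet> u (?N + i))"
      using t L by (intro zx) simp
    also have "(\<Sum>i<L - 1. \<rho> i \<bullet> y (?N + i)) = (\<Sum>i<L - 1. \<Sum>s<?N. c s * (\<rho> i \<bullet> y (s + i)))"
      by (intro sum.cong past_combination_scalar_prod[OF cy] y refl) auto
    also have "(\<Sum>i<L - 1. b i \<bullet> u (?N + i)) = (\<Sum>i<L - 1. \<Sum>s<?N. c s * (b i \<bullet> u (s + i)))"
      by (intro sum.cong comb_u refl) auto
    also have "(\<Sum>i<L - 1. \<Sum>s<?N. c s * (\<rho> i \<bullet> y (s + i))) + (\<Sum>i<L - 1. \<Sum>s<?N. c s * (b i \<bullet> u (s + i)))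
        = (\<Sum>s<?N. c s * ((\<Sum>i<L - 1. \<rho> i \<bullet> y (s + i)) + (\<Sum>i<L - 1. b i \<bullet> u (s + i))))"
      unfolding distrib_left sum.distrib sum_distrib_left by (intro arg_cong2[where f = "(+)"] sum.swap)
    also have "\<dots> = (\<Sum>s<?N. c s * (z \<bullet> x s))"
      using t L by (intro sum.cong refl) (simp add: zx)
    finally show ?thesis .
  qed
  \<comment> \<open>\<open>P z a\<close>: the functional \<open>(z, a)\<close> vanishes on all \<open>(x s, u s, \<dots>, u (s + L - 1))\<close> with
    \<open>s \<le> t - L\<close>.\<close>
  define P where "P z a \<longleftrightarrow> z \<in> carrier_vec n \<and> (\<forall>i. a i \<in> carrier_vec m) \<and>
    (\<forall>s<?N. z \<bullet> x s + (\<Sum>i<L. a i \<bullet> u (s + i)) = 0)" for z and a :: "nat \<Rightarrow> real vec"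
  have "\<exists>z a. P z a \<and> a (L - 1) \<noteq> 0\<^sub>v m"
  proof (rule ccontr)
    assume "\<not> ?thesis"
    then have last: "a (L - 1) = 0\<^sub>v m" if "P z a" for z a
      using that by blast
    \<comment> \<open>Pulling back by one step puts \<open>B\<^sup>T *\<^sub>v z\<close> in front
      and drops the last block, which is zero by \<open>last\<close>.\<close>
    define shift where "shift z a i = (case i of 0 \<Rightarrow> B\<^sup>T *\<^sub>v z | Suc j \<Rightarrow> a j)"
      for z and a :: "nat \<Rightarrow> real vec" and i
    have P_shift: "P (A\<^sup>T *\<^sub>v z) (shift z a)" if P: "P z a" for z a
    proof -
      have z: "z \<in> carrier_vec n" and a: "\<And>i. a i \<in> carrier_vec m"
        using P by (auto simp: P_def)
      \<comment> \<open>Without the last block, the functional at start \<open>?N\<close> involves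
        inputs before time \<open>t\<close> only, not the unchosen \<open>u t\<close>.\<close>
      have trunc: "(\<Sum>i<L. a i \<bullet> u (s + i)) = (\<Sum>i<L - 1. a i \<bullet> u (s + i))" if "s < ?N" for s
      proof -
        have "u (s + (L - 1)) \<in> carrier_vec m"
          using that t L by (intro u) auto
        then show ?thesis
          using L last[OF P] sum.lessThan_Suc[of "\<lambda>i. a i \<bullet> u (s + i)" "L - 1"] by simp
      qed
      have old: "z \<bullet> x s + (\<Sum>i<L - 1. a i \<bullet> u (s + i)) = 0" if "s < ?N" for s
        using P trunc that by (simp add: P_def)
      have "z \<bullet> x ?N + (\<Sum>i<L - 1. a i \<bullet> u (?N + i))
          = (\<Sum>s<?N. c s * (z \<bullet> x s)) + (\<Sum>i<L - 1. \<Sum>s<?N. c s * (a i \<bullet> u (s + i)))"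
        by (intro arg_cong2[where f = "(+)"] comb_x z sum.cong comb_u refl) auto
      also have "\<dots> = (\<Sum>s<?N. c s * (z \<bullet> x s + (\<Sum>i<L - 1. a i \<bullet> u (s + i))))"
        unfolding distrib_left sum.distrib sum_distrib_left
        by (intro arg_cong2[where f = "(+)"] sum.swap refl)
      finally have "z \<bullet> x ?N + (\<Sum>i<L - 1. a i \<bullet> u (?N + i)) = 0"
        using old by simp
      with old have all: "z \<bullet> x s + (\<Sum>i<L - 1. a i \<bullet> u (s + i)) = 0" if "s \<le> ?N" for s
        using that by (cases "s = ?N") auto
      have "(A\<^sup>T *\<^sub>v z) \<bullet> x s + (\<Sum>i<L. shift z a i \<bullet> u (s + i)) = 0" if s: "s < ?N" for s
      proof -
        have us: "u s \<in> carrier_vec m"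
          using s t L by (intro u) auto
        have "(\<Sum>i<L. shift z a i \<bullet> u (s + i)) = (\<Sum>i<Suc (L - 1). shift z a i \<bullet> u (s + i))"
          using L by simp
        also have "\<dots> = (B\<^sup>T *\<^sub>v z) \<bullet> u s + (\<Sum>i<L - 1. a i \<bullet> u (Suc s + i))"
          unfolding sum.lessThan_Suc_shift by (simp add: shift_def)
        finally have "(A\<^sup>T *\<^sub>v z) \<bullet> x s + (\<Sum>i<L. shift z a i \<bullet> u (s + i))
            = z \<bullet> x (Suc s) + (\<Sum>i<L - 1. a i \<bullet> u (Suc s + i))"
          using functional_step[OF A B z x us, of s] by (simp add: x_def)
        then show ?thesis
          using all[of "Suc s"] s by simp
      qed
      moreover have "shift z a i \<in> carrier_vec m" for i
        using B z a by (cases i) (auto simp: shift_def)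
      moreover have "A\<^sup>T *\<^sub>v z \<in> carrier_vec n"
        using A z by auto
      ultimately show ?thesis
        by (simp add: P_def)
    qed
    \<comment> \<open>After \<open>k\<close> shifts the block at \<open>L - 1 - k\<close> has become
      the last one.\<close>
    have tail: "\<forall>z a. P z a \<longrightarrow> k < L \<longrightarrow> a (L - 1 - k) = 0\<^sub>v m" for k
    proof (induction k)
      case 0
      then show ?case
        using last by simp
    next
      case (Suc k)
      show ?case
      proof (intro allI impI)
        fix z a assume "P z a" "Suc k < L"
        then have "shift z a (L - 1 - k) = 0\<^sub>v m"
          using Suc P_shift by (meson Suc_lessD)
        moreover have "L - 1 - k = Suc (L - 1 - Suc k)"
          using \<open>Suc k < L\<close> by simp
        ultimately show "a (L - 1 - Suc k) = 0\<^sub>v m"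
          by (simp add: shift_def)
      qed
    qed
    have a0: "a i = 0\<^sub>v m" if "P z a" "i < L" for z a i
      using tail[of "L - 1 - i"] that by auto
    \<comment> \<open>Every shifted functional has vanishing front block, and iterating the shift
      replaces \<open>z\<close> by its images under powers of \<open>A\<^sup>T\<close>.\<close>
    have modes: "\<forall>z a. P z a \<longrightarrow> (A ^\<^sub>m k * B)\<^sup>T *\<^sub>v z = 0\<^sub>v m" for k
    proof (induction k)
      case 0
      have "B\<^sup>T *\<^sub>v z = 0\<^sub>v m" if "P z a" for z a
        using a0[OF P_shift[OF that], of 0] L by (simp add: shift_def)
      then show ?case
        using A B by auto
    next
      case (Suc k)
      have AB: "A ^\<^sub>m k * B \<in> carrier_mat n m"
        using A B by auto
      have "(A ^\<^sub>m Suc k * B)\<^sup>T *\<^sub>v z = (A ^\<^sub>m k * B)\<^sup>T *\<^sub>v (A\<^sup>T *\<^sub>v z)" if "z \<in> carrier_vec n" for z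
        unfolding pow_mat_Suc_mult[OF A B] transpose_mult[OF A AB]
        using A AB that by (intro assoc_mult_mat_vec[of _ m n _ n]) auto
      then show ?case
        using Suc P_shift by (metis P_def)
    qed
    have z0: "z = 0\<^sub>v n" if "P z a" for z a
      using controllable_left_kernel[OF A B ctrb] modes that by (auto simp: P_def)
    have us: "u (s + i) \<in> carrier_vec m" if "s < ?N" "i < L" for s i
      using that t by (intro u) auto
    have N: "?N < n + L * m"
      using t by (simp add: mult.commute)
    have L1: "1 \<le> L"
      using L by simp
    obtain z a where "z \<in> carrier_vec n" and "\<And>i. a i \<in> carrier_vec m"
      and nz: "z \<noteq> 0\<^sub>v n \<or> (\<exists>i<L. a i \<noteq> 0\<^sub>v m)"
      and "\<And>s. s < ?N \<Longrightarrow> z \<bullet> x s + (\<Sum>i<L. a i \<bullet> u (s + i)) = 0"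
      by (rule few_columns_annihilated[where x = x and u = u and N = ?N, OF x us N L1]) blast+
    then have "P z a"
      by (simp add: P_def)
    then show False
      using z0 a0 nz by blast
  qed
  then obtain z a where P: "P z a" and last: "a (L - 1) \<noteq> 0\<^sub>v m"
    by blast
  then have z: "z \<in> carrier_vec n" and a: "\<And>i. a i \<in> carrier_vec m"
    by (auto simp: P_def)
  obtain \<rho> b where \<rho>: "\<And>i. \<rho> i \<in> carrier_vec p" and b: "\<And>i. b i \<in> carrier_vec m"
    and zx: "\<And>s. s + (L - 1) \<le> t \<Longrightarrow>
      z \<bullet> x s = (\<Sum>i<L - 1. \<rho> i \<bullet> y (s + i)) + (\<Sum>i<L - 1. b i \<bullet> u (s + i))"
    unfolding x_def y_def by (rule state_functional[where u = u and t = t, OF A B C D x0 u full z]) blast+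
  \<comment> \<open>Replacing the state by data changes only the first \<open>L - 1\<close> input
    coefficients. The nonzero block \<open>a (L - 1)\<close> survives and becomes
    \<open>\<eta> 1\<close> once the order is reversed.\<close>
  define \<eta>' where "\<eta>' i = (if i < L - 1 then a i + b i else a i)" for i
  have "(\<Sum>i<L - 1. \<rho> i \<bullet> y (s + i)) + (\<Sum>i<L. \<eta>' i \<bullet> u (s + i)) = 0" if s: "s < ?N" for s
  proof -
    have us: "u (s + i) \<in> carrier_vec m" if "i < L" for i
      using that s t by (intro u) auto
    have split: "(\<Sum>i<L. f i) = (\<Sum>i<L - 1. f i) + f (L - 1)" for f :: "nat \<Rightarrow> real"
      using L sum.lessThan_Suc[of f "L - 1"] by simp
    have "(\<Sum>i<L - 1. \<eta>' i \<bullet> u (s + i)) = (\<Sum>i<L - 1. a i \<bullet> u (s + i)) + (\<Sum>i<L - 1. b i \<bullet> u (s + i))"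
      unfolding sum.distrib[symmetric]
      using a b us by (intro sum.cong refl) (simp add: \<eta>'_def add_scalar_prod_distrib[of _ m])
    then have "(\<Sum>i<L - 1. \<rho> i \<bullet> y (s + i)) + (\<Sum>i<L. \<eta>' i \<bullet> u (s + i))
        = z \<bullet> x s + (\<Sum>i<L. a i \<bullet> u (s + i))"
      using zx[of s] s t unfolding split by (simp add: \<eta>'_def)
    then show ?thesis
      using P s by (simp add: P_def)
  qed
  then have "annihilator m p L u y t (\<lambda>i. \<rho> (L - 1 - i)) (\<lambda>i. \<eta>' (L - i))"
    using \<rho> a b last L by (subst annihilator_iff[OF L t(1) y u]) (auto simp: \<eta>'_def)
  then show ?thesis
    unfolding y_def by blast
qed

lemma selected_carrier:
  assumes "selected m p L u y N" and "s < N"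
  shows "u s \<in> carrier_vec m"
  using assms by (cases "s < L") (auto simp: selected_def admissible_input_def)

theorem theorem3:
  fixes n m p L T :: nat
    and A B C D :: "real mat"
    and x0 :: "real vec"
  assumes "1 \<le> n" and "1 \<le> m" and "1 \<le> p"
    and "A \<in> carrier_mat n n" and "B \<in> carrier_mat n m"
    and "C \<in> carrier_mat p n" and "D \<in> carrier_mat p m"
    and "controllable A B" and "observable C A"
    and "lag C A < L" and "T = n + (m + 1) * L - 1"
    and "x0 \<in> carrier_vec n"
  shows "(\<forall>t\<in>{L..T - 1}. \<forall>u y. y = sys_output A B C D x0 u \<longrightarrow> selected m p L u y t \<longrightarrow>
            window_in_im m p L u y t \<longrightarrow> (\<exists>\<xi> \<eta>. annihilator m p L u y t \<xi> \<eta>)) \<and>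
         (\<forall>u y. y = sys_output A B C D x0 u \<longrightarrow> selected m p L u y T \<longrightarrow>
            mat_rank (hankel p L y 0 (T - 1) @\<^sub>r hankel m L u 0 (T - 1)) = n + m * L)"
proof (intro conjI ballI allI impI)
  have L: "2 \<le> L"
    using obsv_mat_full_rank_lag(1)[OF assms(4,1,9)] assms(10) by simp
  have T: "T = n + m * L + L - 1"
    using assms(11) by simp
  {
    fix t u y
    assume t: "t \<in> {L..T - 1}" and y: "y = sys_output A B C D x0 u"
      and sel: "selected m p L u y t" and win: "window_in_im m p L u y t"
    \<comment> \<open>At the last step \<open>t = T - 1\<close> there are
      \<open>n + m * L - 1\<close> columns, one short of the dimension; the final choice adds the
      missing one.\<close>
    have "t - L + 1 < n + m * L"
      using t T L assms(1) by auto
    then show "\<exists>\<xi> \<eta>. annihilator m p L u y t \<xi> \<eta>"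
      using annihilator_exists[OF assms(1,4-10,12)] t selected_carrier[OF sel] win
      unfolding y by simp
  next
    fix u y
    assume y: "y = sys_output A B C D x0 u" and sel: "selected m p L u y T"
    have "L \<le> T"
      using T assms(1) by simp
    then have "mat_rank (hankel p L y 0 (T - 1) @\<^sub>r hankel m L u 0 (T - 1)) = T - L + 1"
      using selected_full_column_rank[OF L _ _ selected_carrier[OF sel] sel]
        sys_output_carrier[OF assms(7)] unfolding y by simp
    also have "\<dots> = n + m * L"
      using T assms(1) by simp
    finally show "mat_rank (hankel p L y 0 (T - 1) @\<^sub>r hankel m L u 0 (T - 1)) = n + m * L" .
  }
qed

end
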